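(* Let $\mathcal{G}=(\mathcal{V},\mathcal{E})$ be an undirected graph on $N$ nodes with adjacency matrix $\mathbf{A}\in\{0,1\}^{N\times N}$, diagonal degree matrix $\mathbf{D}$ with all degrees positive, and normalized Laplacian $\mathbf{L}=\mathbf{I}_N-\mathbf{D}^{-1/2}\mathbf{A}\mathbf{D}^{-1/2}$. Let $\mathbf{L}=\mathbf{V}\boldsymbol{\Lambda}\mathbf{V}^{\top}$ be an eigendecomposition with $\mathbf{V}\in\mathbb{R}^{N\times N}$ orthogonal and $\boldsymbol{\Lambda}=\operatorname{diag}(\lambda_1,\ldots,\lambda_N)$. Let $\mathbf{s}\in\{-1,1\}^N$ be a sensitive attribute vector with graph Fourier transform $\tilde{\mathbf{s}}=\mathbf{V}^{\top}\mathbf{s}$, and let $\tilde{\mathbf{h}}=[\tilde h_1,\ldots,\tilde h_N]^{\top}\in\mathbb{R}^N$ be the frequency response of a graph filter. Put $\mathbf{A}^{f}:=\mathbf{V}(\mathbf{I}_N-\boldsymbol{\Lambda})\operatorname{diag}(\tilde{\mathbf{h}})\mathbf{V}^{\top}$ and $\rho:=\|\mathbf{s}^{\top}\mathbf{A}^{f}\|_1$. Then $$\rho\;\le\;\sqrt{N}\,\sum_{i=1}^{N}|\tilde{s}_i|\,|1-\lambda_i|\,|\tilde h_i|.$$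
   Context: The adjacency matrix satisfies $A_{ij}=1$ if and only if $(v_i,v_j)\in\mathcal{E}$ (so $\mathbf{A}$ is symmetric), and $D_{ii}$ is the degree of node $v_i$. A graph filter with frequency response $\tilde{\mathbf{h}}$ maps an input signal matrix $\mathbf{X}\in\mathbb{R}^{N\times F}$ to $\mathbf{X}^f=\mathbf{V}\operatorname{diag}(\tilde{\mathbf{h}})\mathbf{V}^{\top}\mathbf{X}$. With $\hat{\mathbf{A}}=\mathbf{D}^{-1/2}\mathbf{A}\mathbf{D}^{-1/2}$, aggregating the filtered signal gives $\hat{\mathbf{A}}\mathbf{X}^f=\mathbf{A}^f\mathbf{X}$, so $\mathbf{A}^f$ is the effective graph topology for the filtered input. For the row vector $\mathbf{s}^{\top}\mathbf{A}^f$, $\|\cdot\|_1$ denotes the sum of the absolute values of its entries; $\rho$ is called the total correlation between $\mathbf{s}$ and $\mathbf{A}^f$. *)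

theory Defs
  imports "HOL-Analysis.Analysis" "Graph_Theory.Pair_Digraph"
begin

definition diag_matrix :: "real ^ 'n \<Rightarrow> real ^ 'n ^ 'n"
  where "diag_matrix x = (\<chi> i j. if i = j then x $ i else 0)"

text \<open>
  A graph on \<open>N\<close> nodes is a graph \<open>G\<close> together with an enumeration \<open>v\<close> of its nodes by a finite
  index type with \<open>N\<close> elements. Undirected graphs are symmetric edge sets (\<^const>\<open>pair_pseudo_graph\<close>);
  self-loops are not excluded.
\<close>

definition adjacency_matrix :: "'v pair_pre_digraph \<Rightarrow> ('n \<Rightarrow> 'v) \<Rightarrow> real ^ 'n ^ 'n"
  where "adjacency_matrix G v = (\<chi> i j. if (v i, v j) \<in> parcs G then 1 else 0)"

text \<open>
  In a symmetric digraph the out-degree counts the neighbours of a node, that is, it is the row sum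
  of the adjacency matrix (a self-loop counts once).
\<close>

definition degree_matrix :: "'v pair_pre_digraph \<Rightarrow> ('n \<Rightarrow> 'v) \<Rightarrow> real ^ 'n ^ 'n"
  where "degree_matrix G v = diag_matrix (\<chi> i. real (out_degree (with_proj G) (v i)))"

text \<open>The power \<open>D\<^sup>p\<close> of a diagonal matrix \<open>D\<close> with positive diagonal entries.\<close>

definition diag_matrix_powr :: "real ^ 'n ^ 'n \<Rightarrow> real \<Rightarrow> real ^ 'n ^ 'n"
  where "diag_matrix_powr D p = diag_matrix (\<chi> i. (D $ i $ i) powr p)"

definition normalized_adjacency :: "'v pair_pre_digraph \<Rightarrow> ('n::finite \<Rightarrow> 'v) \<Rightarrow> real ^ 'n ^ 'n"
  where "normalized_adjacency G v =
    diag_matrix_powr (degree_matrix G v) (- 1 / 2) ** adjacency_matrix G v **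
    diag_matrix_powr (degree_matrix G v) (- 1 / 2)"

definition normalized_laplacian :: "'v pair_pre_digraph \<Rightarrow> ('n::finite \<Rightarrow> 'v) \<Rightarrow> real ^ 'n ^ 'n"
  where "normalized_laplacian G v = mat 1 - normalized_adjacency G v"

definition graph_fourier_transform :: "real ^ 'n ^ 'n \<Rightarrow> real ^ 'n \<Rightarrow> real ^ ('n::finite)"
  where "graph_fourier_transform V x = transpose V *v x"

text \<open>
  The effective topology of a filter with frequency response \<open>h\<close>, with respect to the eigenbasis
  \<open>V\<close> and the eigenvalues \<open>lam\<close> of the normalized Laplacian.
\<close>

definition filtered_adjacency ::
    "real ^ 'n ^ 'n \<Rightarrow> real ^ 'n \<Rightarrow> real ^ 'n \<Rightarrow> real ^ 'n ^ ('n::finite)"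
  where "filtered_adjacency V lam h =
    V ** (mat 1 - diag_matrix lam) ** diag_matrix h ** transpose V"

text \<open>
  The 1-norm of the row vector \<open>s\<^sup>T M\<close>; the library's \<open>norm\<close> on vectors is Euclidean.
\<close>

definition total_correlation :: "real ^ 'n \<Rightarrow> real ^ 'n ^ 'n \<Rightarrow> real"
  where "total_correlation s M = (\<Sum>j\<in>UNIV. \<bar>(s v* M) $ j\<bar>)"

end

(* The row vector s^T A^f is V c with c_i = (V^T s)_i (1 - lam_i) h_i. Cauchy-Schwarz bounds its
   1-norm by sqrt N times its Euclidean norm; the latter equals the Euclidean norm of c, V being
   orthogonal, and is at most the 1-norm of c. *)
theory Submission
  imports Defs
begin

text \<open>Cauchy-Schwarz against the constant vector 1, whose Euclidean norm is
  \<open>sqrt (real CARD('n))\<close>.\<close>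

lemma sum_abs_le_sqrt_card_norm:
  fixes x :: "real ^ 'n::finite"
  shows "(\<Sum>i\<in>UNIV. \<bar>x $ i\<bar>) \<le> sqrt (real CARD('n)) * norm x"
  using L2_set_mult_ineq[of "\<lambda>_. 1" "\<lambda>i. x $ i" UNIV]
  by (simp add: norm_vec_def L2_set_def)

lemma norm_orthogonal_matrix_mult:
  fixes V :: "real ^ 'n ^ 'n::finite"
  assumes "orthogonal_matrix V"
  shows "norm (V *v x) = norm x"
  using assms orthogonal_transformation_matrix[of "(*v) V"] orthogonal_transformation_norm
  by auto

lemma diag_matrix_vector_mult:
  fixes d x :: "real ^ 'n::finite"
  shows "diag_matrix d *v x = (\<chi> i. d $ i * x $ i)"
  \<comment> \<open>Moving the factor inside the conditional leaves a sum in which only the diagonal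
    index survives.\<close>
  by (simp add: diag_matrix_def matrix_vector_mult_def vec_eq_iff if_distrib[of "\<lambda>a. a * _"]
      cong: if_cong)

lemma transpose_diag_matrix: "transpose (diag_matrix d) = diag_matrix d"
  by (auto simp: diag_matrix_def transpose_def vec_eq_iff)

lemma mat_1_minus_diag_matrix: "mat 1 - diag_matrix d = diag_matrix (\<chi> i. 1 - d $ i)"
  by (auto simp: diag_matrix_def mat_def vec_eq_iff)

text \<open>Both factors between \<open>V\<close> and \<open>transpose V\<close> are diagonal, hence
  symmetric: transposing only reverses the product, and they then act entrywise on the Fourier
  coefficients of \<open>s\<close>.\<close>

lemma vector_matrix_mult_filtered_adjacency:
  fixes V :: "real ^ 'n ^ 'n::finite"
  shows "s v* filtered_adjacency V lam h =
    V *v (\<chi> i. graph_fourier_transform V s $ i * (1 - lam $ i) * h $ i)"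
proof -
  have "s v* filtered_adjacency V lam h = transpose (filtered_adjacency V lam h) *v s"
    by simp
  also have "\<dots> = V *v (diag_matrix h *v (diag_matrix (\<chi> i. 1 - lam $ i) *v (transpose V *v s)))"
    by (simp only: filtered_adjacency_def mat_1_minus_diag_matrix matrix_transpose_mul
        transpose_transpose transpose_diag_matrix matrix_vector_mul_assoc)
  finally show ?thesis
    by (simp only: diag_matrix_vector_mult graph_fourier_transform_def) (simp add: mult_ac)
qed

theorem proposition1:
  fixes G :: "'v pair_pre_digraph"
    and v :: "'n::finite \<Rightarrow> 'v"
    and V :: "real ^ 'n ^ 'n"
    and lam h s :: "real ^ 'n"
  assumes "pair_pseudo_graph G"
    and "bij_betw v UNIV (pverts G)"
    and "\<And>i. degree_matrix G v $ i $ i > 0"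
    and "orthogonal_matrix V"
    and "normalized_laplacian G v = V ** diag_matrix lam ** transpose V"
    and "\<And>i. s $ i \<in> {- 1, 1}"
  shows "total_correlation s (filtered_adjacency V lam h)
    \<le> sqrt (real CARD('n)) *
      (\<Sum>i\<in>UNIV. \<bar>graph_fourier_transform V s $ i\<bar> * \<bar>1 - lam $ i\<bar> * \<bar>h $ i\<bar>)"
proof -
  \<comment> \<open>The coordinates of the row vector in the basis of columns of \<open>V\<close>:
    the spectrum of \<open>s\<close>, scaled by 1 - \<open>lam\<close> and by the filter
    response.\<close>
  define c :: "real ^ 'n"
    where "c = (\<chi> i. graph_fourier_transform V s $ i * (1 - lam $ i) * h $ i)"
  have "total_correlation s (filtered_adjacency V lam h) = (\<Sum>j\<in>UNIV. \<bar>(V *v c) $ j\<bar>)"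
    by (simp only: total_correlation_def vector_matrix_mult_filtered_adjacency c_def)
  also have "\<dots> \<le> sqrt (real CARD('n)) * norm (V *v c)"
    by (rule sum_abs_le_sqrt_card_norm)
  also have "\<dots> = sqrt (real CARD('n)) * norm c"
    by (simp only: norm_orthogonal_matrix_mult[OF \<open>orthogonal_matrix V\<close>])
  \<comment> \<open>The 1-norm returns only on the frequency side, where each entry is a product and
    its absolute value splits into the three factors of the bound.\<close>
  also have "\<dots> \<le> sqrt (real CARD('n)) * (\<Sum>i\<in>UNIV. \<bar>c $ i\<bar>)"
    by (intro mult_left_mono norm_le_l1_cart) simp
  finally show ?thesis
    by (simp add: c_def abs_mult)
qed

end
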